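(* Let $(T,V)$ be a pair of operators on a Hilbert space $\mathcal{H}$ such that $T$ is a contraction, $V$ is an isometry, and $T^*V=UVT^*$, where $U$ is a unitary operator on $\mathcal{H}$ and $T,V\in\{U\}'$. Let $S$ on $\mathcal{K}$ be the minimal isometric dilation of $T$. If $\widetilde V$ on $\mathcal{K}$ is an isometric extension of $V$, then $(S,\widetilde V)$ is a pair of doubly twisted isometries on $\mathcal{K}$, and hence there is a Wold-type decomposition for the pair $(S,\widetilde V)$ on the minimal space $\mathcal{K}$. Moreover, the pair $(S,\widetilde V)$ on the minimal space $\mathcal{K}$ is unique up to unitary equivalence.
   Context: $\mathcal{H}$ is a complex separable Hilbert space; operators are bounded linear operators; $\mathbb{Z}_+$ is the set of nonnegative integers; $\{U\}'$ denotes the commutant of $U$, i.e. the set of operators commuting with $U$. A pair $(T_1,T_2)$ of operators on a Hilbert space is called doubly twisted if there is a unitary operator $W$ on that space (a twist) such that $T_1T_2=WT_2T_1$, $T_1^*T_2=W^*T_2T_1^*$, and $T_iW=WT_i$ for $i=1,2$. If $\mathcal{H}\subset\mathcal{K}$ are Hilbert spaces, an operator $S$ on $\mathcal{K}$ is a dilation of $T$ on $\mathcal{H}$ if $T^nh=P_{\mathcal{H}}S^nh$ for all $h\in\mathcal{H}$ and $n\in\mathbb{Z}_+$, where $P_{\mathcal{H}}$ is the orthogonal projection of $\mathcal{K}$ onto $\mathcal{H}$; it is an isometric dilation if $S$ is an isometry, and it is minimal if $\mathcal{K}=\overline{\mathrm{span}}\{S^nh:h\in\mathcal{H},\,n\in\mathbb{Z}_+\}$.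 Every contraction has a minimal isometric dilation, determined up to isomorphism. An isometric extension of $V$ to $\mathcal{K}$ is an isometry $\widetilde V$ on $\mathcal{K}$ with $\widetilde V|_{\mathcal{H}}=V$. An isometry $X$ is a shift if $X^{*m}\to 0$ in the strong operator topology as $m\to\infty$. A Wold-type decomposition for a pair $(V_1,V_2)$ of isometries on $\mathcal{K}$ is an orthogonal decomposition $\mathcal{K}=\mathcal{K}_{uu}\oplus\mathcal{K}_{us}\oplus\mathcal{K}_{su}\oplus\mathcal{K}_{ss}$ into subspaces (some possibly $\{0\}$) reducing both $V_1$ and $V_2$, such that $V_1$ is unitary on $\mathcal{K}_{uu}$ and $\mathcal{K}_{us}$ and a shift on $\mathcal{K}_{su}$ and $\mathcal{K}_{ss}$, while $V_2$ is unitary on $\mathcal{K}_{uu}$ and $\mathcal{K}_{su}$ and a shift on $\mathcal{K}_{us}$ and $\mathcal{K}_{ss}$. Pairs $(A_1,A_2)$ on $\mathcal{K}_1$ and $(B_1,B_2)$ on $\mathcal{K}_2$ are unitarily equivalent if there is a unitary operator $Y:\mathcal{K}_1\to\mathcal{K}_2$ with $YA_i=B_iY$ for $i=1,2$.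
   Formalization: The claim fails for arbitrary isometric extensions (T=0, V=U=1 on C). Proved for extensions with Ṽ Sⁿh = SⁿUⁿVh (h in H), which are shown to exist; uniqueness is proved among isometric extensions doubly twisted with S by a twist restricting to U* on H. *)

theory Defs
  imports "HOL-Analysis.Analysis"
begin

section \<open>Complex Hilbert spaces\<close>

text \<open>
  The inherited real inner product is tied to the complex one by \<open>inner x y = Re (cinner x y)\<close>,
  so norm, topology and completeness are those of the complex inner product.
  The form is linear in its first argument.
\<close>

class complex_hilbert_space = real_inner + complete_space +
  fixes scaleC :: "complex \<Rightarrow> 'a \<Rightarrow> 'a" (infixr "*\<^sub>C" 75)
    and cinner :: "'a \<Rightarrow> 'a \<Rightarrow> complex"
  assumes scaleC_add_right: "c *\<^sub>C (x + y) = c *\<^sub>C x + c *\<^sub>C y"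
    and scaleC_add_left: "(c + d) *\<^sub>C x = c *\<^sub>C x + d *\<^sub>C x"
    and scaleC_scaleC: "c *\<^sub>C (d *\<^sub>C x) = (c * d) *\<^sub>C x"
    and scaleC_one: "1 *\<^sub>C x = x"
    and scaleR_scaleC: "r *\<^sub>R x = complex_of_real r *\<^sub>C x"
    and cinner_add_left: "cinner (x + y) z = cinner x z + cinner y z"
    and cinner_scaleC_left: "cinner (c *\<^sub>C x) y = c * cinner x y"
    and cinner_commute: "cinner x y = cnj (cinner y x)"
    and inner_eq_Re_cinner: "inner x y = Re (cinner x y)"

interpretation complex_vector:
  vector_space "scaleC :: complex \<Rightarrow> 'a \<Rightarrow> 'a::complex_hilbert_space"
  by unfold_locales (simp_all add: scaleC_add_right scaleC_add_left scaleC_scaleC scaleC_one)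

instantiation complex :: complex_hilbert_space
begin

definition scaleC_complex :: "complex \<Rightarrow> complex \<Rightarrow> complex"
  where "scaleC_complex c x = c * x"

definition cinner_complex :: "complex \<Rightarrow> complex \<Rightarrow> complex"
  where "cinner_complex x y = x * cnj y"

instance
  by standard (simp_all add: scaleC_complex_def cinner_complex_def inner_complex_def
      algebra_simps scaleR_conv_of_real)

end

section \<open>Operators\<close>

definition bounded_clinear ::
    "('a::complex_hilbert_space \<Rightarrow> 'b::complex_hilbert_space) \<Rightarrow> bool"
  where "bounded_clinear A \<longleftrightarrow> bounded_linear A \<and> (\<forall>c x. A (c *\<^sub>C x) = c *\<^sub>C A x)"

definition adj ::
    "('a::complex_hilbert_space \<Rightarrow> 'b::complex_hilbert_space) \<Rightarrow> 'b \<Rightarrow> 'a"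
  where "adj A = (SOME B. \<forall>x y. cinner (A x) y = cinner x (B y))"

definition contraction_op ::
    "('a::complex_hilbert_space \<Rightarrow> 'b::complex_hilbert_space) \<Rightarrow> bool"
  where "contraction_op A \<longleftrightarrow> bounded_clinear A \<and> (\<forall>x. norm (A x) \<le> norm x)"

definition isometry_op ::
    "('a::complex_hilbert_space \<Rightarrow> 'b::complex_hilbert_space) \<Rightarrow> bool"
  where "isometry_op A \<longleftrightarrow> bounded_clinear A \<and> (\<forall>x. norm (A x) = norm x)"

definition unitary_op ::
    "('a::complex_hilbert_space \<Rightarrow> 'b::complex_hilbert_space) \<Rightarrow> bool"
  where "unitary_op A \<longleftrightarrow> isometry_op A \<and> surj A"

definition commutant :: "('a::complex_hilbert_space \<Rightarrow> 'a) \<Rightarrow> ('a \<Rightarrow> 'a) set"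
  where "commutant A = {B. bounded_clinear B \<and> A \<circ> B = B \<circ> A}"

definition is_twist ::
    "('a::complex_hilbert_space \<Rightarrow> 'a) \<Rightarrow> ('a \<Rightarrow> 'a) \<Rightarrow> ('a \<Rightarrow> 'a) \<Rightarrow> bool"
  where "is_twist W A B \<longleftrightarrow> unitary_op W
    \<and> A \<circ> B = W \<circ> B \<circ> A
    \<and> adj A \<circ> B = adj W \<circ> B \<circ> adj A
    \<and> A \<circ> W = W \<circ> A \<and> B \<circ> W = W \<circ> B"

definition doubly_twisted ::
    "('a::complex_hilbert_space \<Rightarrow> 'a) \<Rightarrow> ('a \<Rightarrow> 'a) \<Rightarrow> bool"
  where "doubly_twisted A B \<longleftrightarrow>
    bounded_clinear A \<and> bounded_clinear B \<and> (\<exists>W. is_twist W A B)"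

definition unitarily_equivalent ::
    "('a::complex_hilbert_space \<Rightarrow> 'a) \<Rightarrow> ('a \<Rightarrow> 'a) \<Rightarrow>
     ('b::complex_hilbert_space \<Rightarrow> 'b) \<Rightarrow> ('b \<Rightarrow> 'b) \<Rightarrow> bool"
  where "unitarily_equivalent A1 A2 B1 B2 \<longleftrightarrow>
    (\<exists>Y :: 'a \<Rightarrow> 'b. unitary_op Y \<and> Y \<circ> A1 = B1 \<circ> Y \<and> Y \<circ> A2 = B2 \<circ> Y)"

section \<open>Dilations and extensions\<close>

definition orth_proj :: "'a::complex_hilbert_space set \<Rightarrow> 'a \<Rightarrow> 'a"
  where "orth_proj M x = (THE y. y \<in> M \<and> (\<forall>z\<in>M. cinner (x - y) z = 0))"

text \<open>
  The inclusion of \<open>H\<close> in \<open>K\<close> is an isometric linear embedding \<open>J\<close>; the copy of \<open>H\<close> inside \<open>K\<close>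
  is the closed subspace \<open>range J\<close>.
\<close>

definition dilation ::
    "('h::complex_hilbert_space \<Rightarrow> 'k::complex_hilbert_space) \<Rightarrow> ('h \<Rightarrow> 'h) \<Rightarrow> ('k \<Rightarrow> 'k) \<Rightarrow> bool"
  where "dilation J T S \<longleftrightarrow> isometry_op J \<and> bounded_clinear S
    \<and> (\<forall>n h. J ((T ^^ n) h) = orth_proj (range J) ((S ^^ n) (J h)))"

definition minimal_isometric_dilation ::
    "('h::complex_hilbert_space \<Rightarrow> 'k::complex_hilbert_space) \<Rightarrow> ('h \<Rightarrow> 'h) \<Rightarrow> ('k \<Rightarrow> 'k) \<Rightarrow> bool"
  where "minimal_isometric_dilation J T S \<longleftrightarrow> dilation J T S \<and> isometry_op S
    \<and> closure (complex_vector.span {(S ^^ n) (J h) | n h. True}) = UNIV"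

definition isometric_extension ::
    "('h::complex_hilbert_space \<Rightarrow> 'k::complex_hilbert_space) \<Rightarrow> ('h \<Rightarrow> 'h) \<Rightarrow> ('k \<Rightarrow> 'k) \<Rightarrow> bool"
  where "isometric_extension J V V' \<longleftrightarrow> isometry_op V' \<and> (\<forall>h. V' (J h) = J (V h))"

text \<open>
  On a minimal dilation space an isometric extension of \<open>V\<close> is not unique, and in general it
  satisfies no twisting relation with \<open>S\<close>: for \<open>T = 0\<close> and \<open>V = U = 1\<close> on a line, \<open>S\<close> is the
  unilateral shift, and every diagonal unitary that fixes the first basis vector extends \<open>V\<close>.
  The extension that belongs to the relation \<open>T\<^sup>* V = U V T\<^sup>*\<close> is the one that is carried along
  the spanning vectors \<open>S\<^sup>n h\<close> by \<open>S\<^sup>n h \<mapsto> S\<^sup>n U\<^sup>n V h\<close>. The powers of \<open>U\<close> are forced: this is what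
  a twist of \<open>(S, V')\<close> restricting to \<open>U\<^sup>*\<close> on \<open>H\<close> gives.
\<close>

definition adapted_extension ::
    "('h::complex_hilbert_space \<Rightarrow> 'k::complex_hilbert_space) \<Rightarrow> ('h \<Rightarrow> 'h) \<Rightarrow> ('h \<Rightarrow> 'h) \<Rightarrow>
     ('k \<Rightarrow> 'k) \<Rightarrow> ('k \<Rightarrow> 'k) \<Rightarrow> bool"
  where "adapted_extension J U V S V' \<longleftrightarrow> isometric_extension J V V'
    \<and> (\<forall>n h. V' ((S ^^ n) (J h)) = (S ^^ n) (J ((U ^^ n) (V h))))"

definition twist_restricting_to ::
    "('h::complex_hilbert_space \<Rightarrow> 'k::complex_hilbert_space) \<Rightarrow> ('h \<Rightarrow> 'h) \<Rightarrow>
     ('k \<Rightarrow> 'k) \<Rightarrow> ('k \<Rightarrow> 'k) \<Rightarrow> bool"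
  where "twist_restricting_to J R A B \<longleftrightarrow> (\<exists>W. is_twist W A B \<and> (\<forall>h. W (J h) = J (R h)))"

section \<open>Wold-type decompositions\<close>

definition reducing :: "'a::complex_hilbert_space set \<Rightarrow> ('a \<Rightarrow> 'a) \<Rightarrow> bool"
  where "reducing M A \<longleftrightarrow> complex_vector.subspace M \<and> closed M \<and> A ` M \<subseteq> M \<and> adj A ` M \<subseteq> M"

definition unitary_on :: "'a::complex_hilbert_space set \<Rightarrow> ('a \<Rightarrow> 'a) \<Rightarrow> bool"
  where "unitary_on M A \<longleftrightarrow> (\<forall>x\<in>M. norm (A x) = norm x) \<and> A ` M = M"

text \<open>Used for reducing \<open>M\<close>, where the adjoint of the restriction is the restriction of the adjoint.\<close>

definition shift_on :: "'a::complex_hilbert_space set \<Rightarrow> ('a \<Rightarrow> 'a) \<Rightarrow> bool"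
  where "shift_on M A \<longleftrightarrow> (\<forall>x\<in>M. norm (A x) = norm x)
    \<and> (\<forall>x\<in>M. (\<lambda>m. (adj A ^^ m) x) \<longlonglongrightarrow> 0)"

definition orthogonal_sets :: "'a::complex_hilbert_space set \<Rightarrow> 'a set \<Rightarrow> bool"
  where "orthogonal_sets M N \<longleftrightarrow> (\<forall>x\<in>M. \<forall>y\<in>N. cinner x y = 0)"

definition wold_type_decomposition ::
    "('a::complex_hilbert_space \<Rightarrow> 'a) \<Rightarrow> ('a \<Rightarrow> 'a) \<Rightarrow> 'a set \<Rightarrow> 'a set \<Rightarrow> 'a set \<Rightarrow> 'a set \<Rightarrow> bool"
  where "wold_type_decomposition V1 V2 Kuu Kus Ksu Kss \<longleftrightarrow>
    (\<forall>M\<in>{Kuu, Kus, Ksu, Kss}. reducing M V1 \<and> reducing M V2)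
    \<and> orthogonal_sets Kuu Kus \<and> orthogonal_sets Kuu Ksu \<and> orthogonal_sets Kuu Kss
    \<and> orthogonal_sets Kus Ksu \<and> orthogonal_sets Kus Kss \<and> orthogonal_sets Ksu Kss
    \<and> (\<forall>x. \<exists>a\<in>Kuu. \<exists>b\<in>Kus. \<exists>c\<in>Ksu. \<exists>d\<in>Kss. x = a + b + c + d)
    \<and> unitary_on Kuu V1 \<and> unitary_on Kus V1 \<and> shift_on Ksu V1 \<and> shift_on Kss V1
    \<and> unitary_on Kuu V2 \<and> unitary_on Ksu V2 \<and> shift_on Kus V2 \<and> shift_on Kss V2"

end

theory Submission
  imports Defs
begin

text \<open>
  On a minimal isometric dilation \<open>S\<close> of \<open>T\<close> the vectors \<open>S\<^sup>n h\<close> with \<open>h\<close> in \<open>H\<close> are total, and \<open>T\<close>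
  determines their Gram matrix: \<open>\<langle>S\<^sup>m\<^sup>+\<^sup>k h, S\<^sup>m g\<rangle> = \<langle>T\<^sup>k h, g\<rangle>\<close>. A map of these vectors that
  preserves the Gram matrix extends to an isometry (\<open>isometry_of_equal_gram\<close>), and two bounded
  operators that agree on them coincide. Every operator needed here is constructed by the former
  principle, in the form \<open>dilation_intertwiner\<close>, and every relation is checked by the latter.

  The extension of \<open>V\<close> is \<open>S\<^sup>n h \<mapsto> S\<^sup>n U\<^sup>n V h\<close>. It preserves the Gram matrix since
  \<open>\<langle>T\<^sup>k U\<^sup>k V h, V g\<rangle> = \<langle>U\<^sup>k V h, T\<^sup>*\<^sup>k V g\<rangle> = \<langle>U\<^sup>k V h, U\<^sup>k V T\<^sup>*\<^sup>k g\<rangle> = \<langle>T\<^sup>k h, g\<rangle>\<close>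
  (\<open>twisted_gram\<close>). The twist is \<open>W S\<^sup>n h = S\<^sup>n U\<^sup>* h\<close>. The relation that involves \<open>S\<^sup>*\<close> holds because
  \<open>S\<^sup>*\<close> maps \<open>H\<close> to itself by \<open>T\<^sup>*\<close> (\<open>adj_minimal_dilation\<close>), where it is the hypothesis
  \<open>T\<^sup>* V = U V T\<^sup>*\<close>. Conversely, a twist that restricts to \<open>U\<^sup>*\<close> gives \<open>V' S = W\<^sup>* S V'\<close> and so
  forces the formula for the extension (\<open>twist_imp_adapted_extension\<close>). Uniqueness follows: the
  unitary \<open>S\<^sup>n h \<mapsto> S\<^sub>2\<^sup>n h\<close> between two minimal dilation spaces intertwines both operators.

  For the Wold-type decomposition of doubly twisted isometries \<open>A\<close> and \<open>B\<close>, the projections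
  \<open>A\<^sup>n A\<^sup>*\<^sup>n\<close> commute with \<open>B\<close>, as the twists in \<open>A B = W B A\<close> and \<open>A\<^sup>* B = W\<^sup>* B A\<^sup>*\<close> cancel
  (\<open>twist_range_proj_commute\<close>). So \<open>B\<close> reduces the unitary and the shift part of \<open>A\<close>, and
  conversely, and the four intersections of these parts decompose the space.
\<close>

section \<open>Complex inner products\<close>

lemma cinner_add_right: "cinner x (y + z) = cinner x y + cinner x z"
  by (metis cinner_add_left cinner_commute complex_cnj_add)

lemma cinner_scaleC_right: "cinner x (c *\<^sub>C y) = cnj c * cinner x y"
  by (metis cinner_scaleC_left cinner_commute complex_cnj_mult)

lemma cinner_zero_left [simp]: "cinner 0 x = 0"
  using cinner_add_left[of 0 0 x] by simp

lemma cinner_zero_right [simp]: "cinner x 0 = 0"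
  using cinner_add_right[of x 0 0] by simp

lemma cinner_diff_left: "cinner (x - y) z = cinner x z - cinner y z"
  using cinner_add_left[of "x - y" y z] by simp

lemma cinner_diff_right: "cinner x (y - z) = cinner x y - cinner x z"
  using cinner_add_right[of x "y - z" z] by simp

lemma cinner_eq_inner: "cinner x y = Complex (inner x y) (inner x (\<i> *\<^sub>C y))"
  by (simp add: inner_eq_Re_cinner cinner_scaleC_right complex_eq_iff)

lemma cinner_self: "cinner x x = of_real ((norm x)\<^sup>2)"
proof -
  have "cnj (cinner x x) = cinner x x"
    using cinner_commute[of x x] by simp
  then have "Im (cinner x x) = 0"
    by (simp add: complex_eq_iff)
  then show ?thesis
    by (simp add: complex_eq_iff power2_norm_eq_inner inner_eq_Re_cinner)
qed

lemma cinner_eqI: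
  assumes "\<And>z. cinner z x = cinner z y"
  shows "x = y"
proof -
  have "cinner (x - y) (x - y) = 0"
    using assms[of "x - y"] by (simp add: cinner_diff_right)
  then show ?thesis by (simp add: cinner_self)
qed

lemma norm_scaleC: "norm (c *\<^sub>C x) = norm c * norm (x :: 'a::complex_hilbert_space)"
proof -
  have "cinner (c *\<^sub>C x) (c *\<^sub>C x) = (c * cnj c) * cinner x x"
    by (simp add: cinner_scaleC_left cinner_scaleC_right)
  then have "complex_of_real ((norm (c *\<^sub>C x))\<^sup>2) = of_real ((norm c * norm x)\<^sup>2)"
    unfolding cinner_self complex_norm_square[symmetric] by (simp add: power_mult_distrib)
  then have "(norm (c *\<^sub>C x))\<^sup>2 = (norm c * norm x)\<^sup>2"
    using of_real_eq_iff by blast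
  then show ?thesis by simp
qed

lemma bounded_linear_scaleC: "bounded_linear (\<lambda>x :: 'a::complex_hilbert_space. c *\<^sub>C x)"
  by (rule bounded_linear_intro[where K = "norm c"])
    (simp_all add: scaleC_add_right scaleR_scaleC scaleC_scaleC norm_scaleC mult.commute)

lemma closed_cinner_eq_zero: "closed {y. cinner x y = 0}"
  unfolding cinner_eq_inner complex_eq_iff
  by (auto intro!: closed_Collect_conj closed_Collect_eq continuous_intros
      linear_continuous_on[OF bounded_linear_scaleC])

section \<open>Bounded complex-linear operators\<close>

lemma bounded_clinearI:
  assumes "\<And>x y. A (x + y) = A x + A y" "\<And>c x. A (c *\<^sub>C x) = c *\<^sub>C A x"
    and "\<And>x. norm (A x) \<le> norm x * K"
  shows "bounded_clinear A"
  unfolding bounded_clinear_def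
  by (auto intro!: bounded_linear_intro[where K = K] simp: assms scaleR_scaleC)

lemma
  assumes "bounded_clinear A"
  shows bounded_clinear_add: "A (x + y) = A x + A y"
    and bounded_clinear_diff: "A (x - y) = A x - A y"
    and bounded_clinear_scaleC: "A (c *\<^sub>C x) = c *\<^sub>C A x"
    and bounded_clinear_zero: "A 0 = 0"
    and bounded_clinear_tendsto: "(f \<longlongrightarrow> l) F \<Longrightarrow> ((\<lambda>i. A (f i)) \<longlongrightarrow> A l) F"
    and bounded_clinear_continuous_on: "continuous_on X A"
  using assms unfolding bounded_clinear_def
  by (auto simp: linear_simps bounded_linear.tendsto linear_continuous_on)

lemma bounded_clinear_id: "bounded_clinear (\<lambda>x. x)"
  by (simp add: bounded_clinear_def bounded_linear_ident)

lemma bounded_clinear_comp: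
  "bounded_clinear A \<Longrightarrow> bounded_clinear B \<Longrightarrow> bounded_clinear (\<lambda>x. A (B x))"
  by (simp add: bounded_clinear_def bounded_linear_compose)

lemma bounded_clinear_funpow:
  fixes A :: "'a::complex_hilbert_space \<Rightarrow> 'a"
  assumes "bounded_clinear A"
  shows "bounded_clinear (A ^^ n)"
proof (induction n)
  case 0
  then show ?case by (simp add: id_def bounded_clinear_id)
next
  case (Suc n)
  then show ?case using bounded_clinear_comp[OF assms Suc.IH] by (simp add: comp_def)
qed

lemma bounded_clinear_eq_on_total:
  assumes "closure (complex_vector.span X) = UNIV" "bounded_clinear A" "bounded_clinear B"
    and "\<And>x. x \<in> X \<Longrightarrow> A x = B x"
  shows "A x = B x"
proof -
  have "complex_vector.subspace {x. A x = B x}"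
    unfolding complex_vector.subspace_def
    by (simp add: bounded_clinear_add bounded_clinear_scaleC bounded_clinear_zero assms(2,3))
  moreover have "X \<subseteq> {x. A x = B x}"
    using assms(4) by auto
  ultimately have "complex_vector.span X \<subseteq> {x. A x = B x}"
    by (rule complex_vector.span_minimal[rotated])
  moreover have "closed {x. A x = B x}"
    by (intro closed_Collect_eq bounded_clinear_continuous_on assms(2,3))
  ultimately have "closure (complex_vector.span X) \<subseteq> {x. A x = B x}"
    by (rule closure_minimal)
  then show ?thesis
    using assms(1) by auto
qed

section \<open>Adjoints\<close>

text \<open>
  The representing vector is the minimizer of \<open>\<parallel>x\<parallel>\<^sup>2 - 2 f x\<close>. By the parallelogram law a
  minimizing sequence is Cauchy, and the first variation vanishes at its limit.
\<close>

lemma riesz_representation: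
  fixes f :: "'a::{real_inner, complete_space} \<Rightarrow> real"
  assumes f: "bounded_linear f"
  obtains z where "\<And>x. f x = inner x z"
proof -
  interpret f: bounded_linear f by (rule f)
  define q where "q x = (norm x)\<^sup>2 - 2 * f x" for x
  obtain K where K: "\<And>x. norm (f x) \<le> norm x * K"
    using f.bounded by blast
  have "- (K\<^sup>2) \<le> q x" for x
  proof -
    have "f x \<le> norm x * K" using K[of x] by simp
    moreover have "0 \<le> (norm x - K)\<^sup>2" by simp
    ultimately show ?thesis by (simp add: q_def power2_eq_square algebra_simps)
  qed
  then have bdd: "bdd_below (range q)"
    by (auto simp: bdd_below_def)
  define m where "m = Inf (range q)"
  have m: "m \<le> q x" for x
    unfolding m_def by (rule cInf_lower[OF _ bdd]) simp
  have par: "(norm (x - y))\<^sup>2 = 2 * (q x + q y - 2 * q ((1/2) *\<^sub>R (x + y)))" for x y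
    unfolding q_def power2_norm_eq_inner f.scaleR f.add
    by (simp add: algebra_simps inner_commute)
  have "\<exists>x. q x < m + 1 / real (Suc n)" for n
  proof -
    have "Inf (range q) < m + 1 / real (Suc n)" by (simp add: m_def)
    then show ?thesis by (subst (asm) cInf_less_iff[OF _ bdd]) auto
  qed
  then obtain X where X: "\<And>n. q (X n) < m + 1 / real (Suc n)" by metis
  have dX: "(norm (X a - X b))\<^sup>2 < 4 / real (Suc n)" if "n \<le> a" "n \<le> b" for a b n
  proof -
    have "1 / real (Suc a) \<le> 1 / real (Suc n)" "1 / real (Suc b) \<le> 1 / real (Suc n)"
      using that by (simp_all add: field_simps)
    with X[of a] X[of b] m[of "(1/2) *\<^sub>R (X a + X b)"] show ?thesis
      unfolding par by simp
  qed
  have "Cauchy X"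
  proof (rule CauchyI)
    fix e :: real assume e: "0 < e"
    then obtain n where "4 / e\<^sup>2 < real n" using reals_Archimedean2 by blast
    then have "4 < e\<^sup>2 * real (Suc n)"
      using e by (simp add: field_simps) (smt (verit) zero_less_power)
    then have n: "4 / real (Suc n) < e\<^sup>2"
      by (simp add: field_simps)
    have "norm (X a - X b) < e" if "n \<le> a" "n \<le> b" for a b
      using dX[OF that] n e by (intro power2_less_imp_less[of _ e]) simp_all
    then show "\<exists>M. \<forall>a\<ge>M. \<forall>b\<ge>M. norm (X a - X b) < e" by blast
  qed
  then obtain z where z: "X \<longlonglongrightarrow> z"
    using Cauchy_convergent convergent_def by blast
  have "(\<lambda>n. q (X n)) \<longlonglongrightarrow> q z"
    unfolding q_def by (intro tendsto_intros f.tendsto z)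
  moreover have "(\<lambda>n. m + 1 / real (Suc n)) \<longlonglongrightarrow> m + 0"
    by (intro tendsto_intros LIMSEQ_Suc lim_1_over_n)
  ultimately have qz: "q z \<le> m"
    using X by (intro LIMSEQ_le[of "\<lambda>n. q (X n)" _ "\<lambda>n. m + 1 / real (Suc n)"])
      (auto intro: less_imp_le)
  have "f y = inner y z" for y
  proof -
    define d where "d = inner y z - f y"
    define N where "N = inner y y"
    have N: "0 \<le> N" by (simp add: N_def)
    define t where "t = - d / (N + 1)"
    have "q z \<le> q (z + t *\<^sub>R y)" using qz m order_trans by blast
    then have "0 \<le> t\<^sup>2 * N + 2 * t * d"
      unfolding q_def power2_norm_eq_inner f.scaleR f.add d_def N_def
      by (simp add: algebra_simps inner_commute power2_eq_square)
    then have "0 \<le> (N + 1)\<^sup>2 * (t\<^sup>2 * N + 2 * t * d)" by simp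
    also have "\<dots> = (t * (N + 1))\<^sup>2 * N + 2 * (t * (N + 1)) * d * (N + 1)"
      by (simp add: power2_eq_square algebra_simps)
    also have "t * (N + 1) = - d"
      using N by (simp add: t_def)
    finally have "d\<^sup>2 * (N + 2) \<le> 0"
      by (simp add: power2_eq_square algebra_simps)
    then have "d = 0"
      using N by (simp add: mult_le_0_iff)
    then show ?thesis by (simp add: d_def)
  qed
  then show ?thesis by (rule that)
qed

lemma cinner_adj_right:
  assumes A: "bounded_clinear A"
  shows "cinner x (adj A y) = cinner (A x) y"
proof -
  have "\<exists>z. \<forall>x. inner (A x) y = inner x z" for y
  proof -
    have "bounded_linear (\<lambda>x. inner (A x) y)"
      using A unfolding bounded_clinear_def
      by (intro bounded_linear_compose[OF bounded_linear_inner_left]) simp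
    then show ?thesis using riesz_representation by metis
  qed
  then obtain B where B: "\<And>x y. inner (A x) y = inner x (B y)" by metis
  \<comment> \<open>the imaginary part of \<open>cinner x y\<close> is the real inner product of \<open>- \<i> x\<close> with \<open>y\<close>\<close>
  have Im: "Im (cinner x y) = inner ((- \<i>) *\<^sub>C x) y" for x y :: "'c::complex_hilbert_space"
    by (simp add: inner_eq_Re_cinner cinner_scaleC_left del: complex_vector.scale_minus_left)
  have "cinner (A x) y = cinner x (B y)" for x y
  proof (rule complex_eqI)
    show "Re (cinner (A x) y) = Re (cinner x (B y))"
      using B[of x y] by (simp only: inner_eq_Re_cinner)
    have "Im (cinner (A x) y) = inner (A ((- \<i>) *\<^sub>C x)) y"
      unfolding bounded_clinear_scaleC[OF A] by (rule Im)
    also have "\<dots> = inner ((- \<i>) *\<^sub>C x) (B y)"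
      by (rule B)
    also have "\<dots> = Im (cinner x (B y))"
      by (rule Im[symmetric])
    finally show "Im (cinner (A x) y) = Im (cinner x (B y))" .
  qed
  then have "\<exists>B. \<forall>x y. cinner (A x) y = cinner x (B y)" by blast
  then show ?thesis
    unfolding adj_def by (rule someI2_ex) simp
qed

lemma cinner_adj_left: "bounded_clinear A \<Longrightarrow> cinner (adj A x) y = cinner x (A y)"
  using cinner_adj_right[of A y x] by (metis cinner_commute)

lemma adj_eqI:
  assumes "bounded_clinear A" "\<And>x y. cinner (A x) y = cinner x (B y)"
  shows "adj A = B"
proof
  show "adj A y = B y" for y
    by (rule cinner_eqI) (simp add: cinner_adj_right[OF assms(1)] assms(2))
qed

lemma bounded_clinear_adj:
  assumes A: "bounded_clinear A"
  shows "bounded_clinear (adj A)"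
proof -
  obtain K where "0 < K" and K: "\<And>x. norm (A x) \<le> norm x * K"
    using A bounded_linear.pos_bounded unfolding bounded_clinear_def by blast
  show ?thesis
  proof (rule bounded_clinearI[where K = K])
    fix x y c
    show "adj A (x + y) = adj A x + adj A y"
      by (rule cinner_eqI) (simp add: cinner_adj_right[OF A] cinner_add_right)
    show "adj A (c *\<^sub>C x) = c *\<^sub>C adj A x"
      by (rule cinner_eqI) (simp add: cinner_adj_right[OF A] cinner_scaleC_right)
    have "(norm (adj A x))\<^sup>2 = inner (A (adj A x)) x"
      by (simp add: power2_norm_eq_inner inner_eq_Re_cinner cinner_adj_right[OF A])
    also have "\<dots> \<le> norm (adj A x) * K * norm x"
      by (rule order_trans[OF norm_cauchy_schwarz]) (simp add: K mult_right_mono)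
    finally have "norm (adj A x) * norm (adj A x) \<le> norm (adj A x) * (norm x * K)"
      by (simp add: power2_eq_square ac_simps)
    moreover have "0 \<le> norm x * K"
      using \<open>0 < K\<close> by simp
    ultimately show "norm (adj A x) \<le> norm x * K"
      by (cases "adj A x = 0") auto
  qed
qed

lemma adj_adj: "bounded_clinear A \<Longrightarrow> adj (adj A) = A"
  by (intro adj_eqI bounded_clinear_adj cinner_adj_left)

section \<open>Isometries and unitaries\<close>

lemma isometry_op_bounded_clinear: "isometry_op A \<Longrightarrow> bounded_clinear A"
  by (simp add: isometry_op_def)

lemma isometry_opI:
  assumes "\<And>x y. A (x + y) = A x + A y" "\<And>c x. A (c *\<^sub>C x) = c *\<^sub>C A x"
    and "\<And>x. norm (A x) = norm x"
  shows "isometry_op A"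
  unfolding isometry_op_def using assms by (auto intro: bounded_clinearI[where K = 1])

lemma cinner_isometry:
  assumes "isometry_op A"
  shows "cinner (A x) (A y) = cinner x y"
proof -
  note A = isometry_op_bounded_clinear[OF assms]
  have inner: "inner (A x) (A y) = inner x y" for x y
    using assms by (simp add: dot_norm bounded_clinear_add[OF A, symmetric] isometry_op_def)
  show ?thesis
    by (simp add: cinner_eq_inner bounded_clinear_scaleC[OF A, symmetric] inner)
qed

lemma norm_isometry: "isometry_op A \<Longrightarrow> norm (A x) = norm x"
  by (simp add: isometry_op_def)

lemma isometry_op_funpow:
  fixes A :: "'a::complex_hilbert_space \<Rightarrow> 'a"
  assumes "isometry_op A"
  shows "isometry_op (A ^^ n)"
proof -
  have "norm ((A ^^ n) x) = norm x" for x
    by (induction n) (simp_all add: norm_isometry[OF assms])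
  then show ?thesis
    using assms by (simp add: isometry_op_def bounded_clinear_funpow)
qed

lemma adj_isometry: "isometry_op A \<Longrightarrow> adj A (A x) = x"
  by (rule cinner_eqI) (simp add: cinner_adj_right cinner_isometry isometry_op_bounded_clinear)

lemma unitary_op_isometry: "unitary_op A \<Longrightarrow> isometry_op A"
  by (simp add: unitary_op_def)

lemma unitary_op_bounded_clinear: "unitary_op A \<Longrightarrow> bounded_clinear A"
  by (simp add: unitary_op_def isometry_op_def)

lemma adj_unitary_left: "unitary_op A \<Longrightarrow> adj A (A x) = x"
  by (simp add: unitary_op_def adj_isometry)

lemma adj_unitary_right: "unitary_op A \<Longrightarrow> A (adj A x) = x"
  unfolding unitary_op_def by (metis adj_isometry surjD)

lemma unitary_op_adj:
  assumes "unitary_op A"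
  shows "unitary_op (adj A)"
proof -
  have "norm (adj A x) = norm x" for x
    using assms by (metis adj_unitary_right isometry_op_def unitary_op_def)
  moreover have "surj (adj A)"
    by (rule surjI) (rule adj_unitary_left[OF assms])
  ultimately show ?thesis
    using assms by (simp add: unitary_op_def isometry_op_def bounded_clinear_adj)
qed

lemma commute_adj_unitary:
  assumes "unitary_op W" "\<And>x. A (W x) = W (A x)"
  shows "A (adj W x) = adj W (A x)"
  using assms by (metis adj_unitary_left adj_unitary_right)

lemma adj_commute_unitary:
  assumes "unitary_op W" "bounded_clinear A" "\<And>x. A (W x) = W (A x)"
  shows "adj A (W x) = W (adj A x)"
proof (rule cinner_eqI)
  fix z
  note W = unitary_op_bounded_clinear[OF assms(1)]
  have "cinner z (adj A (W x)) = cinner (adj W (A z)) x"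
    by (simp add: cinner_adj_right cinner_adj_left assms(2) W)
  also have "\<dots> = cinner (A (adj W z)) x"
    by (simp add: commute_adj_unitary[where A = A, OF assms(1,3)])
  also have "\<dots> = cinner z (W (adj A x))"
    by (simp add: cinner_adj_right[OF assms(2), symmetric] cinner_adj_left[OF W])
  finally show "cinner z (adj A (W x)) = cinner z (W (adj A x))" .
qed

section \<open>Isometries from equal Gram matrices\<close>

inductive span_graph ::
    "('i \<Rightarrow> 'a::complex_hilbert_space) \<Rightarrow> ('i \<Rightarrow> 'b::complex_hilbert_space) \<Rightarrow> 'a \<Rightarrow> 'b \<Rightarrow> bool"
  for f g where
  gen: "span_graph f g (f i) (g i)"
| zero: "span_graph f g 0 0"
| add: "span_graph f g x y \<Longrightarrow> span_graph f g x' y' \<Longrightarrow> span_graph f g (x + x') (y + y')"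
| scale: "span_graph f g x y \<Longrightarrow> span_graph f g (c *\<^sub>C x) (c *\<^sub>C y)"

text \<open>
  Equality of the Gram matrices makes the closure of \<open>span_graph f g\<close> a norm-preserving linear
  relation, hence the graph of an isometry; it is defined everywhere because \<open>f\<close> is total.
\<close>

lemma isometry_of_equal_gram:
  fixes f :: "'i \<Rightarrow> 'a::complex_hilbert_space" and g :: "'i \<Rightarrow> 'b::complex_hilbert_space"
  assumes gram: "\<And>i j. cinner (f i) (f j) = cinner (g i) (g j)"
    and total: "closure (complex_vector.span (range f)) = UNIV"
  obtains A where "isometry_op A" "\<And>i. A (f i) = g i"
proof -
  let ?G = "span_graph f g"
  have gen: "cinner (f i) x = cinner (g i) y" if "?G x y" for i x y
    using that by induction (simp_all add: gram cinner_add_right cinner_scaleC_right)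
  have cinner: "cinner x x' = cinner y y'" if "?G x y" "?G x' y'" for x y x' y'
    using that(1) by induction (simp_all add: gen[OF that(2)] cinner_add_left cinner_scaleC_left)
  have norm: "norm x = norm y" if "?G x y" for x y
    using cinner[OF that that] by (simp add: cinner_self del: of_real_power)
  have neg: "?G (- x) (- y)" if "?G x y" for x y
    using span_graph.scale[OF that, of "-1"] by simp
  have diff: "norm (x - x') = norm (y - y')" if "?G x y" "?G x' y'" for x y x' y'
    using norm[OF span_graph.add[OF that(1) neg[OF that(2)]]] by simp
  have "complex_vector.subspace {x. \<exists>y. ?G x y}"
    unfolding complex_vector.subspace_def by (auto intro: span_graph.intros)
  then have span: "complex_vector.span (range f) \<subseteq> {x. \<exists>y. ?G x y}"
    by (intro complex_vector.span_minimal) (auto intro: span_graph.gen)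

  define L where "L x y \<longleftrightarrow> (\<exists>X Y. (\<forall>n. ?G (X n) (Y n)) \<and> X \<longlonglongrightarrow> x \<and> Y \<longlonglongrightarrow> y)" for x y
  have L_gen: "L (f i) (g i)" for i
    unfolding L_def
    by (rule exI[of _ "\<lambda>_. f i"], rule exI[of _ "\<lambda>_. g i"]) (simp add: span_graph.gen)
  have L_add: "L (x + x') (y + y')" if xy: "L x y" "L x' y'" for x y x' y'
  proof -
    obtain X Y X' Y' where "\<forall>n. ?G (X n) (Y n)" "X \<longlonglongrightarrow> x" "Y \<longlonglongrightarrow> y"
        "\<forall>n. ?G (X' n) (Y' n)" "X' \<longlonglongrightarrow> x'" "Y' \<longlonglongrightarrow> y'"
      using xy unfolding L_def by blast
    then show ?thesis
      unfolding L_def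
      by (intro exI[of _ "\<lambda>n. X n + X' n"] exI[of _ "\<lambda>n. Y n + Y' n"])
        (auto intro: span_graph.add tendsto_add)
  qed
  have L_scale: "L (c *\<^sub>C x) (c *\<^sub>C y)" if xy: "L x y" for c x y
  proof -
    obtain X Y where "\<forall>n. ?G (X n) (Y n)" "X \<longlonglongrightarrow> x" "Y \<longlonglongrightarrow> y"
      using xy unfolding L_def by blast
    then show ?thesis
      unfolding L_def
      by (intro exI[of _ "\<lambda>n. c *\<^sub>C X n"] exI[of _ "\<lambda>n. c *\<^sub>C Y n"])
        (auto intro: span_graph.scale bounded_linear.tendsto[OF bounded_linear_scaleC])
  qed
  have L_norm: "norm x = norm y" if xy: "L x y" for x y
  proof -
    obtain X Y where XY: "\<forall>n. ?G (X n) (Y n)" "X \<longlonglongrightarrow> x" "Y \<longlonglongrightarrow> y"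
      using xy unfolding L_def by blast
    have "norm (X n) = norm (Y n)" for n
      using XY(1) norm by blast
    then have "(\<lambda>n. norm (X n)) \<longlonglongrightarrow> norm x" "(\<lambda>n. norm (X n)) \<longlonglongrightarrow> norm y"
      using tendsto_norm[OF XY(2)] tendsto_norm[OF XY(3)] by simp_all
    then show ?thesis by (rule LIMSEQ_unique)
  qed
  have L_unique: "y = y'" if "L x y" "L x y'" for x y y'
    using L_norm[OF L_add[OF that(1) L_scale[OF that(2), of "-1"]]] by simp
  have "\<exists>y. L x y" for x
  proof -
    have "x \<in> closure (complex_vector.span (range f))"
      using total by simp
    then obtain X where X: "\<And>n. X n \<in> complex_vector.span (range f)" "X \<longlonglongrightarrow> x"
      unfolding closure_sequential by blast
    then have "\<forall>n. \<exists>y. ?G (X n) y"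
      using span by blast
    then obtain Y where Y: "\<And>n. ?G (X n) (Y n)" by metis
    have "Cauchy X"
      using X(2) LIMSEQ_imp_Cauchy by blast
    then have "Cauchy Y"
      using diff[OF Y Y] by (simp add: Cauchy_def dist_norm)
    then obtain y where "Y \<longlonglongrightarrow> y"
      using Cauchy_convergent convergent_def by blast
    then show ?thesis
      using X(2) Y unfolding L_def by blast
  qed
  then obtain A where A: "\<And>x. L x (A x)" by metis
  have "isometry_op A"
  proof (rule isometry_opI)
    show "A (x + y) = A x + A y" for x y
      using A L_add L_unique by blast
    show "A (c *\<^sub>C x) = c *\<^sub>C A x" for c x
      using A L_scale L_unique by blast
    show "norm (A x) = norm x" for x
      using L_norm[OF A] by simp
  qed
  moreover have "A (f i) = g i" for i
    using A L_gen L_unique by blast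
  ultimately show ?thesis by (rule that)
qed

section \<open>Minimal isometric dilations\<close>

lemma orth_proj_range_isometry:
  assumes "isometry_op J"
  shows "orth_proj (range J) x = J (adj J x)"
  unfolding orth_proj_def
proof (rule the_equality)
  note J = isometry_op_bounded_clinear[OF assms]
  show "J (adj J x) \<in> range J \<and> (\<forall>z\<in>range J. cinner (x - J (adj J x)) z = 0)"
    by (auto simp: cinner_diff_left cinner_isometry[OF assms] cinner_adj_left[OF J])
  fix y assume y: "y \<in> range J \<and> (\<forall>z\<in>range J. cinner (x - y) z = 0)"
  then obtain h where h: "y = J h" by blast
  have "cinner z (adj J x) = cinner z h" for z
  proof -
    have "cinner (x - J h) (J z) = 0" using y h by auto
    then have "cinner (J z) x = cinner z h"
      by (metis cinner_commute cinner_diff_left cinner_isometry[OF assms] eq_iff_diff_eq_0)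
    then show ?thesis by (simp add: cinner_adj_right[OF J])
  qed
  then show "y = J (adj J x)"
    using h cinner_eqI by metis
qed

text \<open>
  The projection in the definition of a dilation is \<open>J J\<^sup>*\<close>, so that definition reads
  \<open>J\<^sup>* S\<^sup>n J = T\<^sup>n\<close>.
\<close>

lemma adj_dilation_power:
  assumes "dilation J T S"
  shows "adj J ((S ^^ n) (J h)) = (T ^^ n) h"
proof -
  have J: "isometry_op J" using assms by (simp add: dilation_def)
  have "J ((T ^^ n) h) = J (adj J ((S ^^ n) (J h)))"
    using assms by (simp add: dilation_def orth_proj_range_isometry)
  then show ?thesis
    using adj_isometry[OF J] by metis
qed

lemma dilation_gram:
  assumes "dilation J T S" "isometry_op S"
  shows "cinner ((S ^^ (m + k)) (J h)) ((S ^^ m) (J g)) = cinner ((T ^^ k) h) g"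
proof -
  have J: "bounded_clinear J" using assms by (simp add: dilation_def isometry_op_def)
  have "cinner ((S ^^ (m + k)) (J h)) ((S ^^ m) (J g)) = cinner ((S ^^ k) (J h)) (J g)"
    by (simp add: funpow_add cinner_isometry[OF isometry_op_funpow[OF assms(2)]])
  then show ?thesis
    by (simp add: cinner_adj_left[OF J, symmetric] adj_dilation_power[OF assms(1)])
qed

lemma minimal_dilation_eqI:
  assumes "minimal_isometric_dilation J T S" "bounded_clinear A" "bounded_clinear B"
    and "\<And>n h. A ((S ^^ n) (J h)) = B ((S ^^ n) (J h))"
  shows "A x = B x"
proof (rule bounded_clinear_eq_on_total[where A = A and B = B])
  show "closure (complex_vector.span {(S ^^ n) (J h) | n h. True}) = UNIV"
    using assms(1) by (simp add: minimal_isometric_dilation_def)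
  show "A y = B y" if "y \<in> {(S ^^ n) (J h) | n h. True}" for y
    using that assms(4) by blast
qed (fact assms(2,3))+

text \<open>
  All operators below that are built on a dilation space arise from this lemma: the extension of
  \<open>V\<close>, the twist and the unitary equivalence are the choices \<open>R n = U\<^sup>n V\<close>, \<open>R n = U\<^sup>*\<close> and
  \<open>R n = 1\<close>. The hypothesis compares the Gram matrices, which \<open>T\<close> determines.
\<close>

lemma dilation_intertwiner:
  assumes min: "minimal_isometric_dilation J T S"
    and min2: "minimal_isometric_dilation J2 T S2"
    and R: "\<And>m k h g. cinner ((T ^^ k) (R (m + k) h)) (R m g) = cinner ((T ^^ k) h) g"
  obtains A where "isometry_op A" "\<And>n h. A ((S ^^ n) (J h)) = (S2 ^^ n) (J2 (R n h))"
proof -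
  define f where "f = (\<lambda>(n, h). (S ^^ n) (J h))"
  define g where "g = (\<lambda>(n, h). (S2 ^^ n) (J2 (R n h)))"
  have S: "dilation J T S" "isometry_op S" and S2: "dilation J2 T S2" "isometry_op S2"
    using min min2 by (auto simp: minimal_isometric_dilation_def)
  have le: "cinner (f (m + k, h)) (f (m, h')) = cinner (g (m + k, h)) (g (m, h'))" for m k h h'
    by (simp add: f_def g_def dilation_gram[OF S] dilation_gram[OF S2] R)
  have "cinner (f i) (f j) = cinner (g i) (g j)" for i j
  proof (cases i, cases j)
    fix n h m h' assume ij: "i = (n, h)" "j = (m, h')"
    show ?thesis
    proof (cases "m \<le> n")
      case True
      then show ?thesis using le[of m "n - m" h h'] by (simp add: ij)
    next
      case False
      then have "cinner (f j) (f i) = cinner (g j) (g i)"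
        using le[of n "m - n" h' h] by (simp add: ij)
      then show ?thesis by (metis cinner_commute)
    qed
  qed
  moreover have "range f = {(S ^^ n) (J h) | n h. True}"
    by (auto simp: f_def)
  then have "closure (complex_vector.span (range f)) = UNIV"
    using min by (simp add: minimal_isometric_dilation_def)
  ultimately obtain A where "isometry_op A" "\<And>i. A (f i) = g i"
    by (rule isometry_of_equal_gram) blast
  then show ?thesis
    using that[of A] by (auto simp: f_def g_def)
qed

text \<open>
  A minimal isometric dilation is a coextension: \<open>J\<^sup>* S = T J\<^sup>*\<close> holds on the spanning vectors,
  because the compression of \<open>S\<^sup>n\<^sup>+\<^sup>1\<close> is \<open>T\<^sup>n\<^sup>+\<^sup>1\<close>; the assertion is its adjoint.
\<close>

lemma adj_minimal_dilation:
  assumes min: "minimal_isometric_dilation J T S" and T: "bounded_clinear T"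
  shows "adj S (J h) = J (adj T h)"
proof -
  have dil: "dilation J T S" using min by (simp add: minimal_isometric_dilation_def)
  then have J: "bounded_clinear J" and S: "bounded_clinear S"
    by (auto simp: dilation_def isometry_op_def)
  have coext: "adj J (S x) = T (adj J x)" for x
  proof (rule minimal_dilation_eqI[OF min, where A = "\<lambda>x. adj J (S x)" and B = "\<lambda>x. T (adj J x)"])
    show "bounded_clinear (\<lambda>x. adj J (S x))"
      by (rule bounded_clinear_comp[OF bounded_clinear_adj[OF J] S])
    show "bounded_clinear (\<lambda>x. T (adj J x))"
      by (rule bounded_clinear_comp[OF T bounded_clinear_adj[OF J]])
    show "adj J (S ((S ^^ n) (J h))) = T (adj J ((S ^^ n) (J h)))" for n h
      using adj_dilation_power[OF dil, of "Suc n" h] by (simp add: adj_dilation_power[OF dil])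
  qed
  show ?thesis
    by (rule cinner_eqI)
      (simp add: cinner_adj_right[OF S] cinner_adj_left[OF J, symmetric] coext
        cinner_adj_right[OF T, symmetric])
qed

section \<open>Extensions and twists on the dilation space\<close>

lemma funpow_commute:
  assumes "\<And>x. A (B x) = B (A x)"
  shows "(A ^^ n) (B x) = B ((A ^^ n) x)"
  by (induction n) (simp_all add: assms)

text \<open>
  Each factor \<open>T\<close> is moved to the right as \<open>T\<^sup>*\<close>, crosses \<open>V\<close> at the price of a factor \<open>U\<close>, and
  this factor cancels one of the factors of \<open>U\<^sup>k\<close>.
\<close>

lemma twisted_gram:
  assumes T: "bounded_clinear T" and V: "isometry_op V" and U: "unitary_op U"
    and UT: "\<And>x. U (T x) = T (U x)" and UV: "\<And>x. U (V x) = V (U x)"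
    and TV: "\<And>x. adj T (V x) = U (V (adj T x))"
  shows "cinner ((T ^^ k) ((U ^^ (m + k)) (V h))) ((U ^^ m) (V g)) = cinner ((T ^^ k) h) g"
proof -
  note Ui = unitary_op_isometry[OF U]
  have main: "cinner ((T ^^ k) ((U ^^ k) (V h))) (V g) = cinner ((T ^^ k) h) g" for h g
  proof (induction k arbitrary: h g)
    case 0
    then show ?case by (simp add: cinner_isometry[OF V])
  next
    case (Suc k)
    have "cinner ((T ^^ Suc k) ((U ^^ Suc k) (V h))) (V g)
        = cinner ((T ^^ k) ((U ^^ k) (V (U h)))) (V (U (adj T g)))"
      by (simp add: cinner_adj_right[OF T, symmetric] TV UV funpow_swap1[of U])
    also have "\<dots> = cinner ((T ^^ k) (U h)) (U (adj T g))"
      by (rule Suc.IH)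
    also have "\<dots> = cinner (U ((T ^^ k) h)) (U (adj T g))"
      by (simp add: funpow_commute[of T U, OF UT[symmetric]])
    also have "\<dots> = cinner ((T ^^ Suc k) h) g"
      by (simp add: cinner_isometry[OF Ui] cinner_adj_right[OF T])
    finally show ?case .
  qed
  have TU: "(T ^^ k) ((U ^^ m) x) = (U ^^ m) ((T ^^ k) x)" for x
    by (rule funpow_commute) (simp add: funpow_commute[of U T, OF UT])
  show ?thesis
    by (simp add: funpow_add TU cinner_isometry[OF isometry_op_funpow[OF Ui]] main)
qed

lemma adapted_extension_exists:
  fixes J :: "'h::complex_hilbert_space \<Rightarrow> 'k::complex_hilbert_space"
  assumes T: "bounded_clinear T" and V: "isometry_op V" and U: "unitary_op U"
    and UT: "\<And>x. U (T x) = T (U x)" and UV: "\<And>x. U (V x) = V (U x)"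
    and TV: "\<And>x. adj T (V x) = U (V (adj T x))"
    and min: "minimal_isometric_dilation J T S"
  shows "\<exists>V'. adapted_extension J U V S V'"
proof -
  obtain A where A: "isometry_op A" "\<And>n h. A ((S ^^ n) (J h)) = (S ^^ n) (J ((U ^^ n) (V h)))"
    using dilation_intertwiner[OF min min, of "\<lambda>n h. (U ^^ n) (V h)"]
      twisted_gram[OF T V U UT UV TV] by blast
  from A(2)[of 0] have "A (J h) = J (V h)" for h by simp
  then show ?thesis
    using A by (auto simp: adapted_extension_def isometric_extension_def)
qed

text \<open>
  The intertwiner that belongs to a right inverse \<open>R'\<close> of \<open>R\<close> is a right inverse of the one that
  belongs to \<open>R\<close>, which is therefore surjective. That \<open>R'\<close> satisfies the Gram condition follows
  from the condition on \<open>R\<close>, applied to \<open>R' h\<close> and \<open>R' g\<close>.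
\<close>

lemma unitary_dilation_intertwiner:
  assumes min: "minimal_isometric_dilation J T S"
    and min2: "minimal_isometric_dilation J2 T S2"
    and R: "\<And>k h g. cinner ((T ^^ k) (R h)) (R g) = cinner ((T ^^ k) h) g"
    and RR': "\<And>h. R (R' h) = h"
  obtains A where "unitary_op A" "\<And>n h. A ((S ^^ n) (J h)) = (S2 ^^ n) (J2 (R h))"
proof -
  obtain A where A: "isometry_op A" "\<And>n h. A ((S ^^ n) (J h)) = (S2 ^^ n) (J2 (R h))"
    using dilation_intertwiner[OF min min2, of "\<lambda>n. R"] R by blast
  have "cinner ((T ^^ k) (R' h)) (R' g) = cinner ((T ^^ k) h) g" for k h g
    using R[of k "R' h" "R' g"] by (simp add: RR')
  then obtain B where B: "isometry_op B" "\<And>n h. B ((S2 ^^ n) (J2 h)) = (S ^^ n) (J (R' h))"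
    using dilation_intertwiner[OF min2 min, of "\<lambda>n. R'"] by blast
  have "A (B y) = y" for y
  proof (rule minimal_dilation_eqI[OF min2, where A = "\<lambda>y. A (B y)" and B = "\<lambda>y. y"])
    show "bounded_clinear (\<lambda>y. A (B y))"
      using A(1) B(1) by (simp add: bounded_clinear_comp[of A B] isometry_op_bounded_clinear)
  qed (simp_all add: bounded_clinear_id A(2) B(2) RR')
  then have "surj A" by (rule surjI)
  with A show ?thesis
    using that[of A] by (simp add: unitary_op_def)
qed

text \<open>
  The twist is the unitary \<open>W\<close> with \<open>W S\<^sup>n h = S\<^sup>n U\<^sup>* h\<close>. All relations are verified on the
  spanning vectors \<open>S\<^sup>n h\<close>. In the one for \<open>S\<^sup>*\<close>, the vectors with \<open>n > 0\<close> only need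
  \<open>S\<^sup>* S = 1\<close>, and those with \<open>n = 0\<close> are handled by \<open>S\<^sup>* h = T\<^sup>* h\<close>.
\<close>

lemma adapted_extension_twist:
  fixes J :: "'h::complex_hilbert_space \<Rightarrow> 'k::complex_hilbert_space"
  assumes T: "bounded_clinear T" and U: "unitary_op U"
    and UT: "\<And>x. U (T x) = T (U x)" and UV: "\<And>x. U (V x) = V (U x)"
    and TV: "\<And>x. adj T (V x) = U (V (adj T x))"
    and min: "minimal_isometric_dilation J T S"
    and ext: "adapted_extension J U V S V'"
  shows "twist_restricting_to J (adj U) S V'"
proof -
  have S: "isometry_op S"
    using min by (simp add: minimal_isometric_dilation_def)
  have V': "bounded_clinear V'" "\<And>h. V' (J h) = J (V h)"
      "\<And>n h. V' ((S ^^ n) (J h)) = (S ^^ n) (J ((U ^^ n) (V h)))"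
    using ext by (simp_all add: adapted_extension_def isometric_extension_def isometry_op_def)
  have V'_Suc: "V' (S ((S ^^ n) (J h))) = S ((S ^^ n) (J (U ((U ^^ n) (V h)))))" for n h
    using V'(3)[of "Suc n" h] by simp
  note Sb = isometry_op_bounded_clinear[OF S]
  note U' = unitary_op_isometry[OF unitary_op_adj[OF U]]
  have TU': "T (adj U x) = adj U (T x)" for x
    by (rule commute_adj_unitary[where A = T, OF U UT[symmetric]])
  have VU': "V (adj U x) = adj U (V x)" for x
    by (rule commute_adj_unitary[where A = V, OF U UV[symmetric]])
  have "cinner ((T ^^ k) (adj U h)) (adj U g) = cinner ((T ^^ k) h) g" for k h g
    by (simp add: funpow_commute[of T "adj U", OF TU'] cinner_isometry[OF U'])
  then obtain W where W: "unitary_op W"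
      and WS: "\<And>n h. W ((S ^^ n) (J h)) = (S ^^ n) (J (adj U h))"
    using unitary_dilation_intertwiner[OF min min, of "adj U" U] adj_unitary_left[OF U] by blast
  note Wb = unitary_op_bounded_clinear[OF W]
  have WS_Suc: "W (S ((S ^^ n) (J h))) = S ((S ^^ n) (J (adj U h)))" for n h
    using WS[of "Suc n" h] by simp
  have W': "adj W ((S ^^ n) (J h)) = (S ^^ n) (J (U h))" for n h
    using WS[of n "U h"] adj_unitary_left[OF W] adj_unitary_left[OF U] by metis
  note comp = bounded_clinear_comp and Sa = bounded_clinear_adj[OF Sb]
  note S_adj = adj_minimal_dilation[OF min T]
  have 1: "S (V' x) = W (V' (S x))" for x
    by (rule minimal_dilation_eqI[OF min, where A = "\<lambda>x. S (V' x)" and B = "\<lambda>x. W (V' (S x))"])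
      (rule comp[OF Sb V'(1)], rule comp[OF Wb comp[OF V'(1) Sb]], simp add: V'(3) V'_Suc WS_Suc adj_unitary_left[OF U])
  have 2: "adj S (V' x) = adj W (V' (adj S x))" for x
  proof (rule minimal_dilation_eqI[OF min, where A = "\<lambda>x. adj S (V' x)"
        and B = "\<lambda>x. adj W (V' (adj S x))"])
    fix n h
    show "adj S (V' ((S ^^ n) (J h))) = adj W (V' (adj S ((S ^^ n) (J h))))"
    proof (cases n)
      \<comment> \<open>the only place where the relation between \<open>T\<^sup>*\<close> and \<open>V\<close> enters the twist\<close>
      case 0
      then show ?thesis
        using W'[of 0 "V (adj T h)"] by (simp add: V'(2) S_adj TV)
    next
      case (Suc m)
      then show ?thesis
        by (simp add: V'_Suc V'(3) adj_isometry[OF S] W')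
    qed
  qed (rule comp[OF Sa V'(1)], rule comp[OF bounded_clinear_adj[OF Wb] comp[OF V'(1) Sa]])
  have 3: "S (W x) = W (S x)" for x
    by (rule minimal_dilation_eqI[OF min, where A = "\<lambda>x. S (W x)" and B = "\<lambda>x. W (S x)"])
      (rule comp[OF Sb Wb], rule comp[OF Wb Sb], simp add: WS WS_Suc)
  have UnU': "(U ^^ n) (adj U x) = adj U ((U ^^ n) x)" for n x
    by (rule funpow_commute) (simp add: adj_unitary_left[OF U] adj_unitary_right[OF U])
  have 4: "V' (W x) = W (V' x)" for x
    by (rule minimal_dilation_eqI[OF min, where A = "\<lambda>x. V' (W x)" and B = "\<lambda>x. W (V' x)"])
      (rule comp[OF V'(1) Wb], rule comp[OF Wb V'(1)], simp add: V'(3) WS VU' UnU')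
  have "is_twist W S V'"
    using W 1 2 3 4 by (auto simp: is_twist_def comp_def)
  moreover have "W (J h) = J (adj U h)" for h
    using WS[of 0 h] by simp
  ultimately show ?thesis
    unfolding twist_restricting_to_def by blast
qed

text \<open>
  A twist \<open>W\<close> gives \<open>V' S = W\<^sup>* S V'\<close>, and \<open>W\<^sup>*\<close> restricts to \<open>U\<close>. So the twisting relation
  determines an extension of \<open>V\<close> on the spanning vectors.
\<close>

lemma twist_imp_adapted_extension:
  assumes U: "unitary_op U"
    and ext: "isometric_extension J V V'" and twist: "twist_restricting_to J (adj U) S V'"
  shows "adapted_extension J U V S V'"
proof -
  obtain W where W: "unitary_op W" and SV: "\<And>x. S (V' x) = W (V' (S x))"
      and SW: "\<And>x. S (W x) = W (S x)" and WJ: "\<And>h. W (J h) = J (adj U h)"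
    using twist unfolding twist_restricting_to_def is_twist_def
    by (auto simp: fun_eq_iff)
  have VS: "V' (S x) = adj W (S (V' x))" for x
    by (simp add: SV adj_unitary_left[OF W])
  have "(S ^^ n) (adj W x) = adj W ((S ^^ n) x)" for n x
    by (rule funpow_commute[of S "adj W", OF commute_adj_unitary[where A = S, OF W SW]])
  then have VSn: "V' ((S ^^ n) x) = (S ^^ n) ((adj W ^^ n) (V' x))" for n x
    by (induction n) (simp_all add: VS commute_adj_unitary[where A = S, OF W SW])
  have "adj W (J h) = J (U h)" for h
    using WJ[of "U h"] adj_unitary_left[OF W] adj_unitary_left[OF U] by metis
  then have "(adj W ^^ n) (J h) = J ((U ^^ n) h)" for n h
    by (induction n) simp_all
  then show ?thesis
    using ext by (simp add: adapted_extension_def isometric_extension_def VSn)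
qed

lemma adapted_extensions_unitarily_equivalent:
  fixes J :: "'h::complex_hilbert_space \<Rightarrow> 'k::complex_hilbert_space"
    and J2 :: "'h \<Rightarrow> 'l::complex_hilbert_space"
  assumes min: "minimal_isometric_dilation J T S" and ext: "adapted_extension J U V S V'"
    and min2: "minimal_isometric_dilation J2 T S2" and ext2: "adapted_extension J2 U V S2 V2"
  shows "unitarily_equivalent S V' S2 V2"
proof -
  obtain Y where Y: "unitary_op Y" "\<And>n h. Y ((S ^^ n) (J h)) = (S2 ^^ n) (J2 h)"
    using unitary_dilation_intertwiner[OF min min2, of "\<lambda>h. h" "\<lambda>h. h"] by blast
  have Y_Suc: "Y (S ((S ^^ n) (J h))) = S2 ((S2 ^^ n) (J2 h))" for n h
    using Y(2)[of "Suc n" h] by simp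
  have bl: "bounded_clinear S" "bounded_clinear S2" "bounded_clinear V'" "bounded_clinear V2"
    and V': "\<And>n h. V' ((S ^^ n) (J h)) = (S ^^ n) (J ((U ^^ n) (V h)))"
    and V2: "\<And>n h. V2 ((S2 ^^ n) (J2 h)) = (S2 ^^ n) (J2 ((U ^^ n) (V h)))"
    using min min2 ext ext2
    by (simp_all add: minimal_isometric_dilation_def adapted_extension_def
        isometric_extension_def isometry_op_def)
  note comp = bounded_clinear_comp and Yb = unitary_op_bounded_clinear[OF Y(1)]
  have "Y (S x) = S2 (Y x)" for x
    by (rule minimal_dilation_eqI[OF min, where A = "\<lambda>x. Y (S x)" and B = "\<lambda>x. S2 (Y x)"])
      (rule comp[OF Yb bl(1)], rule comp[OF bl(2) Yb], simp add: Y(2) Y_Suc)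
  moreover have "Y (V' x) = V2 (Y x)" for x
    by (rule minimal_dilation_eqI[OF min, where A = "\<lambda>x. Y (V' x)" and B = "\<lambda>x. V2 (Y x)"])
      (rule comp[OF Yb bl(3)], rule comp[OF bl(4) Yb], simp add: Y(2) V' V2)
  ultimately show ?thesis
    unfolding unitarily_equivalent_def using Y(1)
    by (intro exI[of _ Y]) (simp add: fun_eq_iff)
qed

section \<open>Wold-type decomposition of doubly twisted isometries\<close>

text \<open>The projection onto the range of \<open>A\<^sup>n\<close>, for an isometry \<open>A\<close>.\<close>

definition range_proj ::
    "('a::complex_hilbert_space \<Rightarrow> 'a) \<Rightarrow> nat \<Rightarrow> 'a \<Rightarrow> 'a"
  where "range_proj A n x = (A ^^ n) ((adj A ^^ n) x)"

text \<open>
  These are the intersection of the ranges of the powers of \<open>A\<close> and its orthogonal complement.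
  The descriptions by range projections turn everything that commutes with these projections
  into an operator that leaves both parts invariant.
\<close>

definition unitary_part :: "('a::complex_hilbert_space \<Rightarrow> 'a) \<Rightarrow> 'a set"
  where "unitary_part A = {x. \<forall>n. range_proj A n x = x}"

definition shift_part :: "('a::complex_hilbert_space \<Rightarrow> 'a) \<Rightarrow> 'a set"
  where "shift_part A = {x. (\<lambda>n. range_proj A n x) \<longlonglongrightarrow> 0}"

lemma range_proj_0 [simp]: "range_proj A 0 x = x"
  by (simp add: range_proj_def)

lemma range_proj_Suc: "range_proj A (Suc n) x = A (range_proj A n (adj A x))"
  by (simp add: range_proj_def funpow_swap1)

lemma range_proj_Suc_isometry:
  assumes "isometry_op A"
  shows "range_proj A (Suc n) (A x) = A (range_proj A n x)"
    and "range_proj A n (adj A x) = adj A (range_proj A (Suc n) x)"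
  by (simp_all add: range_proj_Suc adj_isometry[OF assms])

lemma bounded_clinear_range_proj:
  assumes A: "bounded_clinear A"
  shows "bounded_clinear (range_proj A n)"
proof -
  have "range_proj A n = (\<lambda>x. (A ^^ n) ((adj A ^^ n) x))"
    by (rule ext) (rule range_proj_def)
  moreover have "bounded_clinear (\<lambda>x. (A ^^ n) ((adj A ^^ n) x))"
    by (rule bounded_clinear_comp[OF bounded_clinear_funpow[OF A]
          bounded_clinear_funpow[OF bounded_clinear_adj[OF A]]])
  ultimately show ?thesis by simp
qed

lemma cinner_range_proj:
  assumes A: "bounded_clinear A"
  shows "cinner (range_proj A n x) y = cinner x (range_proj A n y)"
proof -
  have "cinner ((A ^^ n) x) y = cinner x ((adj A ^^ n) y)" for x y
    by (induction n arbitrary: y)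
      (simp_all add: funpow_swap1[of "adj A"] cinner_adj_right[OF A, symmetric])
  moreover have "cinner ((adj A ^^ n) x) y = cinner x ((A ^^ n) y)" for x y
    by (induction n arbitrary: y) (simp_all add: funpow_swap1[of A] cinner_adj_left[OF A])
  ultimately show ?thesis by (simp add: range_proj_def)
qed

lemma range_proj_absorb:
  assumes A: "isometry_op A" and "m \<le> n"
  shows "range_proj A m (range_proj A n x) = range_proj A n x"
proof -
  have cancel: "(adj A ^^ m) ((A ^^ m) y) = y" for y
    by (induction m arbitrary: y) (simp_all add: funpow_swap1 adj_isometry[OF A])
  have "A ^^ n = A ^^ m \<circ> A ^^ (n - m)"
    using \<open>m \<le> n\<close> by (simp flip: funpow_add)
  then show ?thesis by (simp add: range_proj_def cancel)
qed

lemma norm_range_proj: "isometry_op A \<Longrightarrow> norm (range_proj A n x) = norm ((adj A ^^ n) x)"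
  by (simp add: range_proj_def norm_isometry[OF isometry_op_funpow])

lemma norm_diff_range_proj:
  assumes A: "isometry_op A" and "m \<le> n"
  shows "(norm (range_proj A m x - range_proj A n x))\<^sup>2
    = (norm (range_proj A m x))\<^sup>2 - (norm (range_proj A n x))\<^sup>2"
proof -
  note sym = cinner_range_proj[OF isometry_op_bounded_clinear[OF A]]
  have "cinner (range_proj A m x) (range_proj A n x) = cinner (range_proj A n x) (range_proj A n x)"
    using range_proj_absorb[OF A] \<open>m \<le> n\<close> by (simp add: sym)
  then have "inner (range_proj A m x) (range_proj A n x) = (norm (range_proj A n x))\<^sup>2"
    by (simp add: inner_eq_Re_cinner power2_norm_eq_inner)
  then show ?thesis
    by (simp add: power2_norm_eq_inner inner_diff_left inner_diff_right inner_commute)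
qed

text \<open>
  The range projections decrease, so \<open>\<parallel>P\<^sub>m x - P\<^sub>n x\<parallel>\<^sup>2 = \<parallel>P\<^sub>m x\<parallel>\<^sup>2 - \<parallel>P\<^sub>n x\<parallel>\<^sup>2\<close> for \<open>m \<le> n\<close>,
  and \<open>P\<^sub>n x\<close> is Cauchy because the decreasing sequence \<open>\<parallel>P\<^sub>n x\<parallel>\<^sup>2\<close> is. The limit is fixed by
  every range projection, since each of them absorbs all later ones.
\<close>

lemma range_proj_converges:
  assumes A: "isometry_op A"
  obtains p where "(\<lambda>n. range_proj A n x) \<longlonglongrightarrow> p" "p \<in> unitary_part A" "x - p \<in> shift_part A"
proof -
  let ?P = "\<lambda>n. range_proj A n x"
  define a where "a n = (norm (?P n))\<^sup>2" for n
  note bl = bounded_clinear_range_proj[OF isometry_op_bounded_clinear[OF A]]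
  have diff: "(norm (?P m - ?P n))\<^sup>2 = a m - a n" if "m \<le> n" for m n
    using norm_diff_range_proj[OF A that] by (simp add: a_def)
  have "decseq a"
  proof (rule decseq_SucI)
    show "a (Suc n) \<le> a n" for n
      using diff[of n "Suc n"] zero_le_power2[of "norm (?P n - ?P (Suc n))"] by simp
  qed
  then obtain l where "a \<longlonglongrightarrow> l"
    using decseq_convergent[of a 0] by (auto simp: a_def)
  then have "Cauchy a"
    using LIMSEQ_imp_Cauchy by blast
  have "Cauchy ?P"
  proof (rule CauchyI)
    fix e :: real assume e: "0 < e"
    then obtain N where N: "\<And>m n. N \<le> m \<Longrightarrow> N \<le> n \<Longrightarrow> \<bar>a m - a n\<bar> < e\<^sup>2"
      using CauchyD[OF \<open>Cauchy a\<close>, of "e\<^sup>2"] by auto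
    have *: "norm (?P m - ?P n) < e" if "N \<le> m" "m \<le> n" for m n
      using N[of m n] diff[of m n] that e
      by (intro power2_less_imp_less[of _ e]) auto
    have "norm (?P m - ?P n) < e" if "N \<le> m" "N \<le> n" for m n
      using *[of m n] *[of n m] that by (cases "m \<le> n") (auto simp: norm_minus_commute)
    then show "\<exists>N. \<forall>m\<ge>N. \<forall>n\<ge>N. norm (?P m - ?P n) < e" by blast
  qed
  then obtain p where p: "?P \<longlonglongrightarrow> p"
    using Cauchy_convergent convergent_def by blast
  have "range_proj A m p = p" for m
  proof (rule LIMSEQ_unique)
    show "(\<lambda>n. range_proj A m (?P n)) \<longlonglongrightarrow> range_proj A m p"
      by (rule bounded_clinear_tendsto[OF bl p])
    have "eventually (\<lambda>n. range_proj A m (?P n) = ?P n) sequentially"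
      using eventually_ge_at_top[of m] by eventually_elim (rule range_proj_absorb[OF A])
    then show "(\<lambda>n. range_proj A m (?P n)) \<longlonglongrightarrow> p"
      using p by (simp add: tendsto_cong)
  qed
  then have "p \<in> unitary_part A"
    and "(\<lambda>n. range_proj A n (x - p)) = (\<lambda>n. ?P n - p)"
    by (auto simp: unitary_part_def bounded_clinear_diff[OF bl])
  moreover have "(\<lambda>n. ?P n - p) \<longlonglongrightarrow> 0"
    using p by (simp add: LIM_zero)
  ultimately show ?thesis
    using p that by (simp add: shift_part_def)
qed

lemma orthogonal_unitary_part_shift_part:
  assumes A: "isometry_op A" and x: "x \<in> unitary_part A" and y: "y \<in> shift_part A"
  shows "cinner x y = 0"
proof -
  have "inner x y = 0" if x: "x \<in> unitary_part A" and y: "y \<in> shift_part A" for x y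
  proof (rule LIMSEQ_unique)
    have "inner x (range_proj A n y) = inner x y" for n
      using x cinner_range_proj[OF isometry_op_bounded_clinear[OF A], of n x y]
      by (simp add: unitary_part_def inner_eq_Re_cinner)
    then show "(\<lambda>n. inner x (range_proj A n y)) \<longlonglongrightarrow> inner x y" by simp
    show "(\<lambda>n. inner x (range_proj A n y)) \<longlonglongrightarrow> 0"
      using tendsto_inner[OF tendsto_const[of x]] y unfolding shift_part_def by fastforce
  qed
  moreover have "\<i> *\<^sub>C y \<in> shift_part A"
    using y bounded_linear.tendsto[OF bounded_linear_scaleC[of \<i>]]
    by (fastforce simp: shift_part_def bounded_clinear_scaleC
        bounded_clinear_range_proj isometry_op_bounded_clinear[OF A])
  ultimately show ?thesis
    using x y by (simp add: cinner_eq_inner complex_eq_iff)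
qed

lemma shift_part_eq_orthogonal:
  assumes A: "isometry_op A"
  shows "shift_part A = (\<Inter>x\<in>unitary_part A. {y. cinner x y = 0})"
proof (intro equalityI subsetI)
  fix y assume y: "y \<in> (\<Inter>x\<in>unitary_part A. {y. cinner x y = 0})"
  obtain p where p: "p \<in> unitary_part A" "y - p \<in> shift_part A"
    using range_proj_converges[OF A, of y] by blast
  then have "cinner p p = 0"
    using y orthogonal_unitary_part_shift_part[OF A p] by (auto simp: cinner_diff_right)
  then show "y \<in> shift_part A"
    using p(2) by (simp add: cinner_self)
qed (auto simp: orthogonal_unitary_part_shift_part[OF A])

lemma closed_subspace_unitary_part:
  assumes A: "isometry_op A"
  shows "complex_vector.subspace (unitary_part A)" "closed (unitary_part A)"
proof -
  note bl = bounded_clinear_range_proj[OF isometry_op_bounded_clinear[OF A]]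
  show "complex_vector.subspace (unitary_part A)"
    by (simp add: complex_vector.subspace_def unitary_part_def bounded_clinear_zero[OF bl]
        bounded_clinear_add[OF bl] bounded_clinear_scaleC[OF bl])
  show "closed (unitary_part A)"
    unfolding unitary_part_def
    by (intro closed_Collect_all closed_Collect_eq bounded_clinear_continuous_on[OF bl]
        continuous_on_id)
qed

lemma closed_subspace_shift_part:
  assumes A: "isometry_op A"
  shows "complex_vector.subspace (shift_part A)" "closed (shift_part A)"
proof -
  show "complex_vector.subspace (shift_part A)"
    unfolding shift_part_eq_orthogonal[OF A] complex_vector.subspace_def
    by (auto simp: cinner_add_right cinner_scaleC_right)
  show "closed (shift_part A)"
    unfolding shift_part_eq_orthogonal[OF A]
    by (intro closed_INT ballI closed_cinner_eq_zero)
qed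

lemma invariant_parts_if_commute:
  assumes C: "bounded_clinear C" and comm: "\<And>n x. range_proj A n (C x) = C (range_proj A n x)"
  shows "C ` unitary_part A \<subseteq> unitary_part A" "C ` shift_part A \<subseteq> shift_part A"
  using bounded_clinear_tendsto[OF C] bounded_clinear_zero[OF C]
  by (fastforce simp: unitary_part_def shift_part_def comm)+

lemma reducing_parts_self:
  assumes A: "isometry_op A"
  shows "reducing (unitary_part A) A" "reducing (shift_part A) A"
proof -
  note Ab = isometry_op_bounded_clinear[OF A]
  have "range_proj A n (A x) = A x" if "x \<in> unitary_part A" for n x
    using that range_proj_Suc_isometry(1)[OF A] by (cases n) (auto simp: unitary_part_def)
  moreover have "range_proj A n (adj A x) = adj A x" if "x \<in> unitary_part A" for n x
    using that range_proj_Suc_isometry(2)[OF A, of n x] by (auto simp: unitary_part_def)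
  ultimately show "reducing (unitary_part A) A"
    using closed_subspace_unitary_part[OF A] by (auto simp: reducing_def unitary_part_def)
  have "(\<lambda>n. range_proj A n (A x)) \<longlonglongrightarrow> 0" if "x \<in> shift_part A" for x
  proof (rule LIMSEQ_imp_Suc)
    have "(\<lambda>n. range_proj A n x) \<longlonglongrightarrow> 0"
      using that by (simp add: shift_part_def)
    from bounded_clinear_tendsto[OF Ab this] show "(\<lambda>n. range_proj A (Suc n) (A x)) \<longlonglongrightarrow> 0"
      by (simp add: range_proj_Suc_isometry(1)[OF A] bounded_clinear_zero[OF Ab])
  qed
  moreover have "(\<lambda>n. range_proj A n (adj A x)) \<longlonglongrightarrow> 0" if "x \<in> shift_part A" for x
  proof -
    have "(\<lambda>n. range_proj A (Suc n) x) \<longlonglongrightarrow> 0"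
      using that by (intro LIMSEQ_Suc) (simp add: shift_part_def)
    from bounded_clinear_tendsto[OF bounded_clinear_adj[OF Ab] this] show ?thesis
      by (simp add: range_proj_Suc_isometry(2)[OF A]
          bounded_clinear_zero[OF bounded_clinear_adj[OF Ab]])
  qed
  ultimately show "reducing (shift_part A) A"
    using closed_subspace_shift_part[OF A] by (auto simp: reducing_def shift_part_def)
qed

text \<open>
  The two twisting relations cancel: \<open>A A\<^sup>* B = A W\<^sup>* B A\<^sup>* = W\<^sup>* A B A\<^sup>* = B A A\<^sup>*\<close>.
\<close>

lemma twist_range_proj_commute:
  assumes A: "bounded_clinear A" and twist: "is_twist W A B"
  shows "range_proj A n (B x) = B (range_proj A n x)"
proof -
  have W: "unitary_op W" and AB: "\<And>x. A (B x) = W (B (A x))"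
      and A'B: "\<And>x. adj A (B x) = adj W (B (adj A x))" and AW: "\<And>x. A (W x) = W (A x)"
    using twist by (auto simp: is_twist_def fun_eq_iff)
  note AW' = commute_adj_unitary[where A = A, OF W AW]
  note A'W = adj_commute_unitary[where A = A, OF W A AW]
  note A'W' = commute_adj_unitary[where A = "adj A", OF W A'W]
  have PW': "range_proj A n (adj W x) = adj W (range_proj A n x)" for n x
    by (induction n arbitrary: x) (simp_all add: range_proj_Suc AW' A'W')
  show ?thesis
    by (induction n arbitrary: x)
      (simp_all add: range_proj_Suc A'B PW' AW' AB adj_unitary_left[OF W])
qed

lemma reducing_parts_twist:
  assumes A: "isometry_op A" and B: "bounded_clinear B" and twist: "is_twist W A B"
  shows "reducing (unitary_part A) B" "reducing (shift_part A) B"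
proof -
  note Ab = isometry_op_bounded_clinear[OF A]
  note comm = twist_range_proj_commute[OF Ab twist]
  have "range_proj A n (adj B x) = adj B (range_proj A n x)" for n x
    by (rule cinner_eqI)
      (simp add: cinner_range_proj[OF Ab, symmetric] cinner_adj_right[OF B] comm)
  then show "reducing (unitary_part A) B" "reducing (shift_part A) B"
    using closed_subspace_unitary_part[OF A] closed_subspace_shift_part[OF A]
      invariant_parts_if_commute[OF B, of A] comm
      invariant_parts_if_commute[OF bounded_clinear_adj[OF B], of A]
    by (auto simp: reducing_def)
qed

text \<open>
  By symmetry, results on the parts of the first isometry of a twisted pair carry over to the
  second. The relation for \<open>B\<^sup>* A\<close> is the adjoint of the one for \<open>A\<^sup>* B\<close>.
\<close>

lemma is_twist_sym:
  assumes A: "bounded_clinear A" and B: "bounded_clinear B" and twist: "is_twist W A B"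
  shows "is_twist (adj W) B A"
proof -
  have W: "unitary_op W" and AB: "\<And>x. A (B x) = W (B (A x))"
      and A'B: "\<And>x. adj A (B x) = adj W (B (adj A x))"
      and AW: "\<And>x. A (W x) = W (A x)" and BW: "\<And>x. B (W x) = W (B x)"
    using twist by (auto simp: is_twist_def fun_eq_iff)
  note Wb = unitary_op_bounded_clinear[OF W]
  have "adj B (A x) = W (A (adj B x))" for x
  proof (rule cinner_eqI)
    fix z
    have "cinner z (adj B (A x)) = cinner (adj A (B z)) x"
      by (simp add: cinner_adj_right[OF B] cinner_adj_left[OF A])
    also have "\<dots> = cinner (B (adj A z)) (W x)"
      by (simp add: A'B cinner_adj_left[OF Wb])
    also have "\<dots> = cinner z (A (adj B (W x)))"
      by (simp add: cinner_adj_left[OF A, symmetric] cinner_adj_right[OF B])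
    also have "\<dots> = cinner z (W (A (adj B x)))"
      by (simp add: adj_commute_unitary[where A = B, OF W B BW] AW)
    finally show "cinner z (adj B (A x)) = cinner z (W (A (adj B x)))" .
  qed
  then show ?thesis
    by (auto simp: is_twist_def fun_eq_iff unitary_op_adj[OF W] adj_adj[OF Wb] AB
        adj_unitary_left[OF W] commute_adj_unitary[where A = A, OF W AW]
        commute_adj_unitary[where A = B, OF W BW])
qed

lemma reducing_Int: "reducing M A \<Longrightarrow> reducing N A \<Longrightarrow> reducing (M \<inter> N) A"
  by (auto simp: reducing_def complex_vector.subspace_def)

lemma unitary_on_subset_unitary_part:
  assumes A: "isometry_op A" and "reducing M A" "M \<subseteq> unitary_part A"
  shows "unitary_on M A"
proof -
  have "x \<in> A ` M" if "x \<in> M" for x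
  proof
    show "x = A (adj A x)"
      using that assms(3) range_proj_Suc[of A 0 x] by (auto simp: unitary_part_def)
    show "adj A x \<in> M"
      using that assms(2) by (auto simp: reducing_def)
  qed
  then show ?thesis
    using assms(2) by (auto simp: unitary_on_def reducing_def norm_isometry[OF A])
qed

lemma shift_on_subset_shift_part:
  assumes A: "isometry_op A" and "M \<subseteq> shift_part A"
  shows "shift_on M A"
proof -
  have "(\<lambda>n. (adj A ^^ n) x) \<longlonglongrightarrow> 0" if "x \<in> M" for x
  proof (rule tendsto_norm_zero_cancel)
    have "(\<lambda>n. norm (range_proj A n x)) \<longlonglongrightarrow> 0"
      using that assms(2) by (intro tendsto_norm_zero) (auto simp: shift_part_def)
    then show "(\<lambda>n. norm ((adj A ^^ n) x)) \<longlonglongrightarrow> 0"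
      by (simp add: norm_range_proj[OF A])
  qed
  then show ?thesis
    by (simp add: shift_on_def norm_isometry[OF A])
qed

text \<open>
  Both components of \<open>x\<close> stay in a reducing subspace, since they are limits of vectors
  \<open>A\<^sup>n A\<^sup>*\<^sup>n x\<close>. This makes the decompositions for \<open>A\<close> and for \<open>B\<close> compatible.
\<close>

lemma decompose_in_reducing:
  assumes A: "isometry_op A" and M: "reducing M A" and x: "x \<in> M"
  obtains p q where "p \<in> M \<inter> unitary_part A" "q \<in> M \<inter> shift_part A" "x = p + q"
proof -
  obtain p where p: "(\<lambda>n. range_proj A n x) \<longlonglongrightarrow> p" "p \<in> unitary_part A" "x - p \<in> shift_part A"
    using range_proj_converges[OF A] .
  have "range_proj A n x \<in> M" for n
  proof -
    have "(adj A ^^ n) x \<in> M"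
      using M x by (induction n) (auto simp: reducing_def)
    moreover have "(A ^^ n) y \<in> M" if "y \<in> M" for y
      using M that by (induction n) (auto simp: reducing_def)
    ultimately show ?thesis by (simp add: range_proj_def)
  qed
  then have "p \<in> M"
    using M closed_sequentially[OF _ _ p(1), of M] by (simp add: reducing_def)
  moreover from this have "x - p \<in> M"
    using M x by (simp add: reducing_def complex_vector.subspace_diff)
  ultimately show ?thesis
    using that[of p "x - p"] p by simp
qed

text \<open>
  Each isometry of the pair reduces the unitary and the shift part of the other one. Decomposing
  \<open>x\<close> with respect to \<open>A\<close> and then both components with respect to \<open>B\<close> gives the four summands.
\<close>

lemma doubly_twisted_wold_decomposition:
  assumes A: "isometry_op A" and B: "isometry_op B" and twist: "is_twist W A B"
  shows "wold_type_decomposition A B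
    (unitary_part A \<inter> unitary_part B) (unitary_part A \<inter> shift_part B)
    (shift_part A \<inter> unitary_part B) (shift_part A \<inter> shift_part B)"
proof -
  note bl = isometry_op_bounded_clinear[OF A] isometry_op_bounded_clinear[OF B]
  note red = reducing_parts_self[OF A] reducing_parts_self[OF B]
    reducing_parts_twist[OF A bl(2) twist] reducing_parts_twist[OF B bl(1) is_twist_sym[OF bl twist]]
  note orth = orthogonal_unitary_part_shift_part[OF A] orthogonal_unitary_part_shift_part[OF B]
  have orth': "cinner y x = 0" if "cinner x y = 0" for x y
    using that cinner_commute[of y x] by simp
  have "\<exists>a\<in>unitary_part A \<inter> unitary_part B. \<exists>b\<in>unitary_part A \<inter> shift_part B.
      \<exists>c\<in>shift_part A \<inter> unitary_part B. \<exists>d\<in>shift_part A \<inter> shift_part B. x = a + b + c + d" for x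
  proof -
    have "reducing UNIV A"
      by (simp add: reducing_def)
    then obtain p q where pq: "p \<in> unitary_part A" "q \<in> shift_part A" "x = p + q"
      using decompose_in_reducing[OF A, of UNIV x] by blast
    obtain a b where ab: "a \<in> unitary_part A \<inter> unitary_part B"
        "b \<in> unitary_part A \<inter> shift_part B" "p = a + b"
      using decompose_in_reducing[OF B red(5) pq(1)] .
    obtain c d where cd: "c \<in> shift_part A \<inter> unitary_part B"
        "d \<in> shift_part A \<inter> shift_part B" "q = c + d"
      using decompose_in_reducing[OF B red(6) pq(2)] .
    have "x = a + b + c + d"
      by (simp add: pq(3) ab(3) cd(3) add.assoc)
    with ab cd show ?thesis by blast
  qed
  then show ?thesis
    unfolding wold_type_decomposition_def orthogonal_sets_def
    by (auto intro!: reducing_Int red unitary_on_subset_unitary_part[OF A]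
        unitary_on_subset_unitary_part[OF B] shift_on_subset_shift_part[OF A]
        shift_on_subset_shift_part[OF B] intro: orth orth')
qed

theorem theorem5p3:
  fixes T V U :: "'h::{complex_hilbert_space, second_countable_topology} \<Rightarrow> 'h"
    and J :: "'h \<Rightarrow> 'k::complex_hilbert_space"
    and S :: "'k \<Rightarrow> 'k"
  assumes "contraction_op T"
    and "isometry_op V"
    and "unitary_op U"
    and "T \<in> commutant U"
    and "V \<in> commutant U"
    and "adj T \<circ> V = U \<circ> V \<circ> adj T"
    and "minimal_isometric_dilation J T S"
  shows "(\<exists>V'. adapted_extension J U V S V')
    \<and> (\<forall>V'. adapted_extension J U V S V' \<longrightarrow>
          isometry_op S \<and> isometry_op V' \<and> doubly_twisted S V'
          \<and> twist_restricting_to J (adj U) S V'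
          \<and> (\<exists>Kuu Kus Ksu Kss. wold_type_decomposition S V' Kuu Kus Ksu Kss))
    \<and> (\<forall>V' (J2 :: 'h \<Rightarrow> 'l::complex_hilbert_space) S2 V2.
          isometric_extension J V V' \<and> twist_restricting_to J (adj U) S V'
          \<and> minimal_isometric_dilation J2 T S2
          \<and> isometric_extension J2 V V2 \<and> twist_restricting_to J2 (adj U) S2 V2
          \<longrightarrow> unitarily_equivalent S V' S2 V2)"
proof -
  have T: "bounded_clinear T"
    using assms(1) by (simp add: contraction_op_def)
  have UT: "U (T x) = T (U x)" and UV: "U (V x) = V (U x)"
    and TV: "adj T (V x) = U (V (adj T x))" for x
    using assms(4-6) by (auto simp: commutant_def fun_eq_iff)
  note V = assms(2) and U = assms(3) and min = assms(7)
  have S: "isometry_op S"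
    using min by (simp add: minimal_isometric_dilation_def)
  have part2: "isometry_op V' \<and> doubly_twisted S V' \<and> twist_restricting_to J (adj U) S V'
      \<and> (\<exists>Kuu Kus Ksu Kss. wold_type_decomposition S V' Kuu Kus Ksu Kss)"
    if ext: "adapted_extension J U V S V'" for V'
  proof -
    have V': "isometry_op V'"
      using ext by (simp add: adapted_extension_def isometric_extension_def)
    have twist: "twist_restricting_to J (adj U) S V'"
      by (rule adapted_extension_twist[OF T U UT UV TV min ext])
    then obtain W where "is_twist W S V'"
      by (auto simp: twist_restricting_to_def)
    with V' twist show ?thesis
      using doubly_twisted_wold_decomposition[OF S V', of W] isometry_op_bounded_clinear S
      unfolding doubly_twisted_def by blast
  qed
  have "unitarily_equivalent S V' S2 V2"
    if "isometric_extension J V V'" "twist_restricting_to J (adj U) S V'"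
      "minimal_isometric_dilation J2 T S2"
      "isometric_extension J2 V V2" "twist_restricting_to J2 (adj U) S2 V2"
    for V' and J2 :: "'h \<Rightarrow> 'l" and S2 V2
    using adapted_extensions_unitarily_equivalent[OF min _ that(3)]
      twist_imp_adapted_extension[OF U that(1,2)] twist_imp_adapted_extension[OF U that(4,5)]
    by blast
  then show ?thesis
    using adapted_extension_exists[OF T V U UT UV TV min] part2 S by blast
qed

end
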